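(* Let $\mathcal{A}_1,\mathcal{A}_2$ (agents) and $\mathcal{B}_1,\mathcal{B}_2$ (tasks) be pairwise disjoint finite nonempty sets with $|\mathcal{A}_1|\ge|\mathcal{B}_1|$ and $|\mathcal{A}_2|\ge|\mathcal{B}_2|$. Put $\mathcal{A}_3=\mathcal{A}_1\cup\mathcal{A}_2$, $\mathcal{B}_3=\mathcal{B}_1\cup\mathcal{B}_2$, and for $k=1,2,3$ let $\mathcal{G}_k$ be the complete bipartite graph with vertex set $\mathcal{V}_k=\mathcal{A}_k\cup\mathcal{B}_k$ and edge set $\mathcal{E}_k=\{\{i,j\}\mid i\in\mathcal{A}_k,\ j\in\mathcal{B}_k\}$. Let $w:\mathcal{E}_3\to\mathbb{R}$ be a weight function. For $k=1,2$ let $\mathcal{M}_k$ be a solution to $BOT(\mathcal{G}_k)$, let $e_k\in\arg\max_{e\in\mathcal{M}_k}w(e)$, and assume that $e_k$ is a critical bottleneck edge of $\mathcal{G}_k$ relative to $\mathcal{M}_k$ and that $\mathcal{G}_k$ is a bottleneck cluster relative to $e_k$ (with solution $\mathcal{M}_k$). Let $\mathcal{S}_\mu(\mathcal{G}_1)$, $\mathcal{S}_\nu(\mathcal{G}_1)$ be alternating trees decomposing $\mathcal{G}_1$ with respect to $\mathcal{M}_1$ and $e_1$, as defined in the context, the former rooted at the agent of $e_1$ and the latter at the task of $e_1$. Assume that $w(e_1)>w(e_2)$ and that $\arg\max_{e\in\mathcal{M}_1}w(e)$ is a singleton. Suppose that there do not exist an agent $i\in\mathcal{A}_2$ and a task $j\in\mathcal{B}_2$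 for which all three of the following conditions hold: (i) there is a task $b'$ in the vertex set of $\mathcal{S}_\nu(\mathcal{G}_1)$ with $w(\{i,b'\})<w(e_1)$; (ii) there is an agent $a'$ in the vertex set of $\mathcal{S}_\mu(\mathcal{G}_1)$ with $w(\{a',j\})<w(e_1)$; (iii) there is a path $P\subseteq\mathcal{E}_3$ between $i$ and $j$ that is alternating relative to $\mathcal{M}_2$, contains only edges of weight less than $w(e_1)$, and satisfies $|P\cap\mathcal{M}_2|>|P\setminus\mathcal{M}_2|$. Then $\mathcal{M}_1\cup\mathcal{M}_2$ is a solution to $BOT(\mathcal{G}_3)$.
   Context: Matchings and BAP. A matching is a set of edges such that no vertex is incident with more than one of them; an MCM is a matching of maximum cardinality. For a complete bipartite graph $\mathcal{G}_b$ with agent set $\mathcal{A}_b$, task set $\mathcal{B}_b$, vertex set $\mathcal{V}_b=\mathcal{A}_b\cup\mathcal{B}_b$, edge set $\mathcal{E}_b$ and real edge weights $w$, the problem $BOT(\mathcal{G}_b)$ is to minimise $\max_{e\in\mathcal{M}}w(e)$ over all MCMs $\mathcal{M}$ of $\mathcal{G}_b$; a solution is an MCM attaining the minimum. A bottleneck edge of $\mathcal{G}_b$ is any $e\in\arg\max_{e'\in\mathcal{M}}w(e')$ for any solution $\mathcal{M}$ of $BOT(\mathcal{G}_b)$. Paths. A path between $v_1$ and $v_{l+1}$ is a set of edges $\{\{v_k,v_{k+1}\}\}_{k=1,\dots,l}$ with $v_1,\dots,v_{l+1}$ distinct vertices; $l$ is its length (the empty path, $l=0$, joins a vertex to itself).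 A path $P$ is alternating relative to a matching $\mathcal{M}$ if every vertex incident to an edge of $P$ is incident with at most one edge of $P\cap\mathcal{M}$ and at most one edge of $P\setminus\mathcal{M}$. A vertex is free relative to $\mathcal{M}$ if it is incident with no edge of $\mathcal{M}$. An augmenting path relative to $\mathcal{M}$ is an alternating path relative to $\mathcal{M}$ of length at least one between two (distinct) free vertices. A tree with a designated root is an alternating tree relative to $\mathcal{M}$ if the path in the tree from the root to every other vertex is alternating relative to $\mathcal{M}$. Pruned edge set. For an MCM $\mathcal{M}$ of $\mathcal{G}_b$, $\phi(\mathcal{G}_b,\mathcal{M})=\mathcal{M}\cup\{e\in\mathcal{E}_b\mid w(e)<\max_{e'\in\mathcal{M}}w(e')\}$. Critical bottleneck edge. For an MCM $\mathcal{M}$ of $\mathcal{G}_b$, an edge $e_c$ is a critical bottleneck edge of $\mathcal{G}_b$ relative to $\mathcal{M}$ if $e_c\in\arg\max_{e\in\mathcal{M}}w(e)$ and $\phi(\mathcal{G}_b,\mathcal{M})\setminus\{e_c\}$ does not contain an augmenting path relative to $\mathcal{M}\setminus\{e_c\}$. Bottleneck cluster. Let $\mathcal{M}_b$ be a solution to $BOT(\mathcal{G}_b)$ and $e=\{a_b,b_b\}\in\mathcal{M}_b$ (with $a_b$ an agent, $b_b$ a task) a bottleneck edge of $\mathcal{G}_b$. $\mathcal{G}_b$ is a bottleneck cluster relative to $e$ (with solution $\mathcal{M}_b$) if for every vertex $v\in\mathcal{V}_b$ there is a path $P\subseteq\phi(\mathcal{G}_b,\mathcal{M}_b)$ between $v$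 and $b_b$ that is alternating relative to $\mathcal{M}_b$ (for $v=b_b$ the empty path is allowed). Tree decomposition. Let $\mathcal{M}_b$ be a solution to $BOT(\mathcal{G}_b)$, $e_c=\{a_c,b_c\}\in\mathcal{M}_b$ ($a_c$ agent, $b_c$ task) a critical bottleneck edge of $\mathcal{G}_b$ relative to $\mathcal{M}_b$, and $\mathcal{G}_b$ a bottleneck cluster relative to $e_c$. Then $\mathcal{S}_\mu(\mathcal{G}_b)=(\mathcal{V}_\mu,\mathcal{E}_\mu)$ and $\mathcal{S}_\nu(\mathcal{G}_b)=(\mathcal{V}_\nu,\mathcal{E}_\nu)$ denote subgraphs of $\mathcal{G}_b$ with $a_c\in\mathcal{V}_\mu$, $b_c\in\mathcal{V}_\nu$, $\mathcal{V}_\mu\cup\mathcal{V}_\nu=\mathcal{V}_b$, $\mathcal{V}_\mu\cap\mathcal{V}_\nu=\emptyset$, $\mathcal{E}_\mu\cup\mathcal{E}_\nu\subseteq\phi(\mathcal{G}_b,\mathcal{M}_b)$, that are alternating trees relative to $\mathcal{M}_b$ with roots $a_c$ and $b_c$ respectively. In the corollary this is applied to $\mathcal{G}_1$ with $\mathcal{M}_1$ and $e_1$. *)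

theory Defs
  imports Complex_Main
begin

section \<open>Graphs\<close>

text \<open>A graph is a pair of a vertex set and a set of edges; an edge is the set of its two
  end points.\<close>

type_synonym 'v graph = "'v set \<times> 'v set set"

abbreviation verts :: "'v graph \<Rightarrow> 'v set" where
  "verts G \<equiv> fst G"

abbreviation edges :: "'v graph \<Rightarrow> 'v set set" where
  "edges G \<equiv> snd G"

definition graph :: "'v graph \<Rightarrow> bool" where
  "graph G \<longleftrightarrow> (\<forall>e \<in> edges G. e \<subseteq> verts G \<and> card e = 2)"

definition subgraph :: "'v graph \<Rightarrow> 'v graph \<Rightarrow> bool" where
  "subgraph H G \<longleftrightarrow> graph H \<and> verts H \<subseteq> verts G \<and> edges H \<subseteq> edges G"

definition complete_bipartite :: "'v set \<Rightarrow> 'v set \<Rightarrow> 'v graph" where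
  "complete_bipartite A B = (A \<union> B, {{i, j} | i j. i \<in> A \<and> j \<in> B})"

section \<open>Paths and trees\<close>

definition path_edges :: "'v list \<Rightarrow> 'v set set" where
  "path_edges vs = {{vs ! k, vs ! Suc k} | k. Suc k < length vs}"

text \<open>A path is a set of edges. The vertices being distinct, its length is its cardinality;
  the empty path joins every vertex to itself.\<close>

definition path_between :: "'v \<Rightarrow> 'v \<Rightarrow> 'v set set \<Rightarrow> bool" where
  "path_between u v P \<longleftrightarrow>
     (\<exists>vs. vs \<noteq> [] \<and> distinct vs \<and> hd vs = u \<and> last vs = v \<and> P = path_edges vs)"

definition connected_graph :: "'v graph \<Rightarrow> bool" where
  "connected_graph G \<longleftrightarrow>
     verts G \<noteq> {} \<and> (\<forall>u \<in> verts G. \<forall>v \<in> verts G. \<exists>P \<subseteq> edges G. path_between u v P)"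

definition cycle :: "'v set set \<Rightarrow> bool" where
  "cycle C \<longleftrightarrow>
     (\<exists>vs. 3 \<le> length vs \<and> distinct vs \<and> C = insert {last vs, hd vs} (path_edges vs))"

definition tree :: "'v graph \<Rightarrow> bool" where
  "tree T \<longleftrightarrow> graph T \<and> connected_graph T \<and> \<not> (\<exists>C \<subseteq> edges T. cycle C)"

section \<open>Matchings\<close>

definition matching :: "'v graph \<Rightarrow> 'v set set \<Rightarrow> bool" where
  "matching G M \<longleftrightarrow> M \<subseteq> edges G \<and> (\<forall>v. \<exists>\<^sub>\<le>\<^sub>1 e. e \<in> M \<and> v \<in> e)"

definition mcm :: "'v graph \<Rightarrow> 'v set set \<Rightarrow> bool" where
  "mcm G M \<longleftrightarrow> is_arg_max card (matching G) M"

definition alternating :: "'v set set \<Rightarrow> 'v set set \<Rightarrow> bool" where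
  "alternating M P \<longleftrightarrow>
     (\<forall>v \<in> \<Union>P. (\<exists>\<^sub>\<le>\<^sub>1 e. e \<in> P \<inter> M \<and> v \<in> e) \<and> (\<exists>\<^sub>\<le>\<^sub>1 e. e \<in> P - M \<and> v \<in> e))"

definition free_vertex :: "'v set set \<Rightarrow> 'v \<Rightarrow> bool" where
  "free_vertex M v \<longleftrightarrow> (\<forall>e \<in> M. v \<notin> e)"

definition augmenting_path :: "'v set set \<Rightarrow> 'v set set \<Rightarrow> bool" where
  "augmenting_path M P \<longleftrightarrow>
     alternating M P \<and> 1 \<le> card P \<and>
     (\<exists>u v. u \<noteq> v \<and> free_vertex M u \<and> free_vertex M v \<and> path_between u v P)"

text \<open>The quantified path \<open>P\<close> from the root to \<open>v\<close> exists and is unique because \<open>T\<close> is a tree.\<close>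

definition alternating_tree :: "'v set set \<Rightarrow> 'v \<Rightarrow> 'v graph \<Rightarrow> bool" where
  "alternating_tree M r T \<longleftrightarrow>
     tree T \<and> r \<in> verts T \<and>
     (\<forall>v \<in> verts T - {r}. \<forall>P \<subseteq> edges T. path_between r v P \<longrightarrow> alternating M P)"

section \<open>Bottleneck assignment\<close>

definition arg_max_set :: "('a \<Rightarrow> 'b::linorder) \<Rightarrow> 'a set \<Rightarrow> 'a set" where
  "arg_max_set f S = {x. is_arg_max f (\<lambda>y. y \<in> S) x}"

definition bot_solution :: "('v set \<Rightarrow> real) \<Rightarrow> 'v graph \<Rightarrow> 'v set set \<Rightarrow> bool" where
  "bot_solution w G M \<longleftrightarrow> is_arg_min (\<lambda>N. Max (w ` N)) (mcm G) M"

definition bottleneck_edge :: "('v set \<Rightarrow> real) \<Rightarrow> 'v graph \<Rightarrow> 'v set \<Rightarrow> bool" where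
  "bottleneck_edge w G e \<longleftrightarrow> (\<exists>M. bot_solution w G M \<and> e \<in> arg_max_set w M)"

definition pruned_edges :: "('v set \<Rightarrow> real) \<Rightarrow> 'v graph \<Rightarrow> 'v set set \<Rightarrow> 'v set set" where
  "pruned_edges w G M = M \<union> {e \<in> edges G. w e < Max (w ` M)}"

definition critical_bottleneck_edge ::
    "('v set \<Rightarrow> real) \<Rightarrow> 'v graph \<Rightarrow> 'v set set \<Rightarrow> 'v set \<Rightarrow> bool" where
  "critical_bottleneck_edge w G M e \<longleftrightarrow>
     mcm G M \<and> e \<in> arg_max_set w M \<and>
     \<not> (\<exists>P \<subseteq> pruned_edges w G M - {e}. augmenting_path (M - {e}) P)"

text \<open>From here on the graph is given by its agents \<open>A\<close> and tasks \<open>B\<close>, since the two end points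
  of an edge play different roles.\<close>

definition bottleneck_cluster ::
    "('v set \<Rightarrow> real) \<Rightarrow> 'v set \<Rightarrow> 'v set \<Rightarrow> 'v set set \<Rightarrow> 'v set \<Rightarrow> bool" where
  "bottleneck_cluster w A B M e \<longleftrightarrow>
     (let G = complete_bipartite A B in
      bot_solution w G M \<and> e \<in> M \<and> bottleneck_edge w G e \<and>
      (\<exists>a \<in> A. \<exists>b \<in> B. e = {a, b} \<and>
         (\<forall>v \<in> verts G. \<exists>P \<subseteq> pruned_edges w G M. path_between v b P \<and> alternating M P)))"

definition tree_decomposition ::
    "('v set \<Rightarrow> real) \<Rightarrow> 'v set \<Rightarrow> 'v set \<Rightarrow> 'v set set \<Rightarrow> 'v set
       \<Rightarrow> 'v graph \<Rightarrow> 'v graph \<Rightarrow> bool" where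
  "tree_decomposition w A B M e S\<^sub>\<mu> S\<^sub>\<nu> \<longleftrightarrow>
     (let G = complete_bipartite A B in
      subgraph S\<^sub>\<mu> G \<and> subgraph S\<^sub>\<nu> G \<and>
      verts S\<^sub>\<mu> \<union> verts S\<^sub>\<nu> = verts G \<and> verts S\<^sub>\<mu> \<inter> verts S\<^sub>\<nu> = {} \<and>
      edges S\<^sub>\<mu> \<union> edges S\<^sub>\<nu> \<subseteq> pruned_edges w G M \<and>
      (\<exists>a \<in> A. \<exists>b \<in> B. e = {a, b} \<and> a \<in> verts S\<^sub>\<mu> \<and> b \<in> verts S\<^sub>\<nu> \<and>
         alternating_tree M a S\<^sub>\<mu> \<and> alternating_tree M b S\<^sub>\<nu>))"

end

theory Submission
  imports Defs
begin

text \<open>Criticality together with the cluster property forces both matchings to be perfect. Criticality of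
  \<open>e\<^sub>1\<close> also forbids edges lighter than \<open>w e\<^sub>1\<close> from a task of \<open>S\<^sub>\<nu>\<close> to an agent of \<open>S\<^sub>\<mu>\<close>, and it makes
  \<open>M\<^sub>1 - {e\<^sub>1}\<close> respect the two trees: otherwise the tree paths would close up to an augmenting
  path. Suppose some maximum matching \<open>N\<close> of the union has all weights below \<open>w e\<^sub>1\<close>. Let \<open>S\<close> be the
  set of tasks in \<open>S\<^sub>\<nu>\<close> together with the tasks of the second graph reachable by a light alternating
  path from an agent satisfying (i). If no pair satisfies (i)--(iii), every \<open>N\<close>-partner of a task
  in \<open>S\<close> is matched by \<open>M\<^sub>1 \<union> M\<^sub>2\<close> to a task in \<open>S\<close> other than the task of \<open>e\<^sub>1\<close>. This maps the finite
  set \<open>S\<close> injectively into a proper subset of itself.\<close>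

section \<open>Alternating paths\<close>

lemma path_edgesI: "Suc k < length vs \<Longrightarrow> {vs ! k, vs ! Suc k} \<in> path_edges vs"
  by (auto simp: path_edges_def)

lemma finite_path_edges [simp]: "finite (path_edges vs)"
proof -
  have "path_edges vs \<subseteq> (\<lambda>k. {vs ! k, vs ! Suc k}) ` {..<length vs}"
    by (auto simp: path_edges_def)
  then show ?thesis
    by (rule finite_subset) simp
qed

lemma card_path_edges_ge_1:
  assumes "Suc 0 < length vs"
  shows "1 \<le> card (path_edges vs)"
proof -
  have "path_edges vs \<noteq> {}"
    using path_edgesI[OF assms] by blast
  then show ?thesis
    by (simp add: Suc_leI card_gt_0_iff)
qed

lemma path_between_distinctE:
  assumes "path_between u v P" "u \<noteq> v"
  obtains vs where "distinct vs" "P = path_edges vs" "Suc 0 < length vs"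
    "vs ! 0 = u" "vs ! (length vs - 1) = v"
proof -
  obtain vs where vs: "vs \<noteq> []" "distinct vs" "hd vs = u" "last vs = v" "P = path_edges vs"
    using assms(1) by (auto simp: path_between_def)
  then have "Suc 0 < length vs"
    using assms(2) by (cases vs) (auto split: if_splits)
  then show thesis
    using that[of vs] vs by (simp add: hd_conv_nth last_conv_nth)
qed

text \<open>Two path edges that share a vertex have equal or adjacent indices, and adjacent indices
  differ in parity. Hence distinct edges that meet are never both inside or both outside
  \<open>M\<close>. The flag \<open>c\<close> tells whether the first edge is matched.\<close>

lemma alternating_parityI:
  assumes d: "distinct vs"
    and p: "\<And>k. Suc k < length vs \<Longrightarrow> {vs ! k, vs ! Suc k} \<in> M \<longleftrightarrow> (even k \<longleftrightarrow> c)"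
  shows "alternating M (path_edges vs)"
proof -
  have key: "e = e'"
    if e: "e \<in> path_edges vs" "e' \<in> path_edges vs" and *: "v \<in> e" "v \<in> e'" "e \<in> M \<longleftrightarrow> e' \<in> M" for e e' v
  proof -
    obtain k where k: "Suc k < length vs" "e = {vs ! k, vs ! Suc k}"
      using e(1) by (auto simp: path_edges_def)
    obtain l where l: "Suc l < length vs" "e' = {vs ! l, vs ! Suc l}"
      using e(2) by (auto simp: path_edges_def)
    have "even k \<longleftrightarrow> even l"
      using p[OF k(1)] p[OF l(1)] *(3) k(2) l(2) by auto
    moreover have "k = l \<or> k = Suc l \<or> l = Suc k"
      using *(1,2) k l d by (auto simp: nth_eq_iff_index_eq)
    ultimately show ?thesis
      using k l by auto
  qed
  then show ?thesis
    unfolding alternating_def Uniq_def by blast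
qed

text \<open>Consecutive edges are distinct and share an inner vertex, so exactly one of them is
  matched. The status of the first edge thus decides that of all others by parity.\<close>

lemma alternating_parityD:
  assumes d: "distinct vs" and alt: "alternating M (path_edges vs)" and "Suc k < length vs"
  shows "{vs ! k, vs ! Suc k} \<in> M \<longleftrightarrow> (even k \<longleftrightarrow> {vs ! 0, vs ! Suc 0} \<in> M)"
  using assms(3)
proof (induction k)
  case (Suc k)
  let ?e = "{vs ! k, vs ! Suc k}" and ?f = "{vs ! Suc k, vs ! Suc (Suc k)}"
  have mem: "?e \<in> path_edges vs" "?f \<in> path_edges vs"
    using Suc.prems by (auto intro!: path_edgesI)
  have ne: "?e \<noteq> ?f"
    using d Suc.prems by (auto simp: doubleton_eq_iff nth_eq_iff_index_eq)
  have "vs ! Suc k \<in> \<Union> (path_edges vs)"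
    using mem by blast
  then have "\<exists>\<^sub>\<le>\<^sub>1 e. e \<in> path_edges vs \<inter> M \<and> vs ! Suc k \<in> e"
    "\<exists>\<^sub>\<le>\<^sub>1 e. e \<in> path_edges vs - M \<and> vs ! Suc k \<in> e"
    using alt unfolding alternating_def by blast+
  then have "?f \<in> M \<longleftrightarrow> ?e \<notin> M"
    using mem ne unfolding Uniq_def by blast
  then show ?case
    using Suc by auto
qed simp

lemma complete_bipartite_edge:
  "e \<in> edges (complete_bipartite A B) \<longleftrightarrow> (\<exists>i\<in>A. \<exists>j\<in>B. e = {i, j})"
  by (auto simp: complete_bipartite_def)

lemma bipartite_path_step:
  assumes "path_edges vs \<subseteq> edges (complete_bipartite A B)" "Suc k < length vs"
  shows "vs ! k \<in> A \<and> vs ! Suc k \<in> B \<or> vs ! k \<in> B \<and> vs ! Suc k \<in> A"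
proof -
  have "{vs ! k, vs ! Suc k} \<in> edges (complete_bipartite A B)"
    using assms path_edgesI by blast
  then show ?thesis
    by (auto simp: complete_bipartite_edge doubleton_eq_iff)
qed

lemma bipartite_path_parity:
  assumes "path_edges vs \<subseteq> edges (complete_bipartite A B)" "A \<inter> B = {}" "k < length vs"
  shows "vs ! k \<in> A \<longleftrightarrow> (even k \<longleftrightarrow> vs ! 0 \<in> A)"
  using assms(3)
proof (induction k)
  case (Suc k)
  then show ?case
    using bipartite_path_step[OF assms(1), of k] assms(2) by auto
qed simp

section \<open>Matchings of complete bipartite graphs\<close>

lemma matching_unique:
  assumes "matching G M" "e \<in> M" "f \<in> M" "v \<in> e" "v \<in> f"
  shows "e = f"
  using assms unfolding matching_def Uniq_def by blast

text \<open>Choosing the task end of every edge is injective on a matching, which gives the bound.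
  Equality makes this choice surjective, so every task has an agent partner
  \<open>n y\<close>.\<close>

lemma matching_saturation:
  assumes fin: "finite A" "finite B" and dis: "A \<inter> B = {}"
    and M: "matching (complete_bipartite A B) M"
  shows "finite M" and "card M \<le> card B"
    and "card M = card B \<Longrightarrow> \<exists>n. inj_on n B \<and> n ` B \<subseteq> A \<and> (\<forall>y\<in>B. {n y, y} \<in> M)"
proof -
  have sub: "M \<subseteq> edges (complete_bipartite A B)"
    using M by (simp add: matching_def)
  then have "M \<subseteq> Pow (A \<union> B)"
    by (auto simp: complete_bipartite_def)
  then show finM: "finite M"
    using fin by (meson finite_Pow_iff finite_UnI finite_subset)
  have "\<forall>e\<in>M. \<exists>y\<in>B. y \<in> e"
    using sub by (fastforce simp: complete_bipartite_edge)
  then obtain h where h: "\<And>e. e \<in> M \<Longrightarrow> h e \<in> B \<and> h e \<in> e"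
    by metis
  then have im: "h ` M \<subseteq> B"
    by blast
  have inj: "inj_on h M"
    using matching_unique[OF M] h by (metis inj_onI)
  show "card M \<le> card B"
    using card_inj_on_le[OF inj im fin(2)] .
  assume "card M = card B"
  then have surj: "h ` M = B"
    using im fin(2) by (simp add: card_image card_subset_eq inj)
  have "\<forall>y\<in>B. \<exists>x\<in>A. {x, y} \<in> M"
  proof
    fix y assume y: "y \<in> B"
    then obtain e where e: "e \<in> M" "y \<in> e"
      using surj h by force
    then obtain i j where "i \<in> A" "j \<in> B" "e = {i, j}"
      using sub by (meson complete_bipartite_edge subsetD)
    then show "\<exists>x\<in>A. {x, y} \<in> M"
      using e y dis by auto
  qed
  then obtain n where n: "\<And>y. y \<in> B \<Longrightarrow> n y \<in> A \<and> {n y, y} \<in> M"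
    by metis
  have "inj_on n B"
  proof (rule inj_onI)
    fix y z assume yz: "y \<in> B" "z \<in> B" "n y = n z"
    have "n y \<in> {n z, z}"
      using yz(3) by simp
    then have "{n y, y} = {n z, z}"
      using matching_unique[OF M, of "{n y, y}" "{n z, z}" "n y"] n yz by blast
    then show "y = z"
      using yz(3) by (auto simp: doubleton_eq_iff)
  qed
  then show "\<exists>n. inj_on n B \<and> n ` B \<subseteq> A \<and> (\<forall>y\<in>B. {n y, y} \<in> M)"
    using n by blast
qed

lemma ex_saturating_matching:
  assumes "finite A" "finite B" "A \<inter> B = {}" "card B \<le> card A"
  shows "\<exists>M. matching (complete_bipartite A B) M \<and> card M = card B"
proof -
  obtain f where f: "inj_on f B" "f ` B \<subseteq> A"
    using card_le_inj[OF assms(2,1,4)] by blast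
  have "matching (complete_bipartite A B) ((\<lambda>y. {f y, y}) ` B)"
    unfolding matching_def
  proof
    show "(\<lambda>y. {f y, y}) ` B \<subseteq> edges (complete_bipartite A B)"
      using f(2) by (fastforce simp: complete_bipartite_edge)
    show "\<forall>v. \<exists>\<^sub>\<le>\<^sub>1 e. e \<in> (\<lambda>y. {f y, y}) ` B \<and> v \<in> e"
    proof (intro allI Uniq_I)
      fix v e e'
      assume *: "e \<in> (\<lambda>y. {f y, y}) ` B \<and> v \<in> e" "e' \<in> (\<lambda>y. {f y, y}) ` B \<and> v \<in> e'"
      then obtain y z where yz: "y \<in> B" "z \<in> B" "e = {f y, y}" "e' = {f z, z}"
        by blast
      then have "f y \<in> A" "f z \<in> A"
        using f(2) by auto
      then have "f y = f z \<or> y = z"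
        using * yz assms(3) by auto
      then show "e = e'"
        using yz inj_onD[OF f(1)] by blast
    qed
  qed
  moreover have "inj_on (\<lambda>y. {f y, y}) B"
    using f assms(3) by (auto simp: inj_on_def doubleton_eq_iff)
  ultimately show ?thesis
    by (intro exI[of _ "(\<lambda>y. {f y, y}) ` B"] conjI card_image)
qed

text \<open>Any injection of the tasks into the agents yields a matching that attains the bound
  \<open>card B\<close>. Maximality therefore becomes a condition on cardinality alone.\<close>

lemma mcm_complete_bipartite_iff:
  assumes "finite A" "finite B" "A \<inter> B = {}" "card B \<le> card A"
  shows "mcm (complete_bipartite A B) M \<longleftrightarrow>
    matching (complete_bipartite A B) M \<and> card M = card B"
proof -
  obtain N where "matching (complete_bipartite A B) N" "card N = card B"
    using ex_saturating_matching[OF assms] by blast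
  moreover have le: "matching (complete_bipartite A B) K \<Longrightarrow> card K \<le> card B" for K
    using matching_saturation(2)[OF assms(1-3)] .
  ultimately have "mcm (complete_bipartite A B) M \<Longrightarrow> card B \<le> card M"
    unfolding mcm_def is_arg_max_def by (simp add: not_less) metis
  then show ?thesis
    using le unfolding mcm_def is_arg_max_def by (auto simp: not_less intro: le_antisym)
qed

text \<open>If no agent is free, the edges of \<open>M\<close> correspond one to one to the agents.
  Then \<open>card A = card M = card B\<close>, and the injective partner map is onto
  \<open>B\<close>.\<close>

lemma perfect_matching_partner:
  assumes fin: "finite A" "finite B" and dis: "A \<inter> B = {}"
    and M: "matching (complete_bipartite A B) M" and card: "card M = card B"
    and sat: "\<And>a. a \<in> A \<Longrightarrow> \<not> free_vertex M a"
  obtains m where "bij_betw m A B" "M = (\<lambda>x. {x, m x}) ` A"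
proof -
  have sub: "e \<in> M \<Longrightarrow> \<exists>i\<in>A. \<exists>j\<in>B. e = {i, j}" for e
    using M unfolding matching_def by (meson complete_bipartite_edge subsetD)
  have "\<forall>a\<in>A. \<exists>b\<in>B. {a, b} \<in> M"
  proof
    fix a assume a: "a \<in> A"
    then obtain e where e: "e \<in> M" "a \<in> e"
      using sat by (auto simp: free_vertex_def)
    with sub obtain i j where "i \<in> A" "j \<in> B" "e = {i, j}"
      by blast
    then show "\<exists>b\<in>B. {a, b} \<in> M"
      using e a dis by auto
  qed
  then obtain m where m: "\<And>a. a \<in> A \<Longrightarrow> m a \<in> B \<and> {a, m a} \<in> M"
    by metis
  have img: "M = (\<lambda>x. {x, m x}) ` A"
  proof
    show "M \<subseteq> (\<lambda>x. {x, m x}) ` A"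
    proof
      fix e assume e: "e \<in> M"
      with sub obtain i j where ij: "i \<in> A" "j \<in> B" "e = {i, j}"
        by blast
      then have "e = {i, m i}"
        using matching_unique[OF M e, of "{i, m i}" i] m by auto
      then show "e \<in> (\<lambda>x. {x, m x}) ` A"
        using ij by blast
    qed
  qed (use m in auto)
  have "inj_on (\<lambda>x. {x, m x}) A"
    using m dis by (fastforce simp: inj_on_def doubleton_eq_iff)
  then have cA: "card A = card B"
    using card_image[of "\<lambda>x. {x, m x}" A] img card by simp
  have "inj_on m A"
  proof (rule inj_onI)
    fix x y assume xy: "x \<in> A" "y \<in> A" "m x = m y"
    have "m x \<in> {y, m y}"
      using xy(3) by simp
    then have "{x, m x} = {y, m y}"
      using matching_unique[OF M, of "{x, m x}" "{y, m y}" "m x"] m xy by blast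
    then show "x = y"
      using xy(3) by (auto simp: doubleton_eq_iff)
  qed
  moreover have "m ` A \<subseteq> B"
    using m by blast
  ultimately have "bij_betw m A B"
    using card_subset_eq[OF fin(2)] cA card_image[of m A] by (simp add: bij_betw_def)
  then show thesis
    using img that by blast
qed

section \<open>Pruned edges, and criticality leaving no agent free\<close>

lemma pruned_edges_subset: "M \<subseteq> edges G \<Longrightarrow> pruned_edges w G M \<subseteq> edges G"
  by (auto simp: pruned_edges_def)

lemma arg_max_set_Max:
  assumes "finite M" "e \<in> arg_max_set w M"
  shows "e \<in> M" and "w e = Max (w ` M)"
proof -
  show e: "e \<in> M"
    using assms(2) by (simp add: arg_max_set_def is_arg_max_def)
  show "w e = Max (w ` M)"
    using assms e
    by (intro Max_eqI[symmetric]) (auto simp: arg_max_set_def is_arg_max_def not_less)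
qed

text \<open>The cluster property joins a free agent to the task of \<open>e\<close> by an
  alternating pruned path. This path avoids \<open>e\<close>, and deleting \<open>e\<close> from the
  matching frees the task, so the path is augmenting relative to \<open>M - {e}\<close>, against
  criticality.\<close>

lemma bottleneck_cluster_no_free_agent:
  assumes dis: "A \<inter> B = {}" and a: "a \<in> A"
    and crit: "critical_bottleneck_edge w (complete_bipartite A B) M e"
    and clus: "bottleneck_cluster w A B M e"
  shows "\<not> free_vertex M a"
proof
  assume free: "free_vertex M a"
  let ?G = "complete_bipartite A B"
  have M: "matching ?G M"
    using crit by (simp add: critical_bottleneck_edge_def mcm_def is_arg_max_def)
  then have sub: "pruned_edges w ?G M \<subseteq> edges ?G"
    by (intro pruned_edges_subset) (simp add: matching_def)
  have "a \<in> verts ?G"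
    using a by (simp add: complete_bipartite_def)
  moreover obtain a' b where e: "e \<in> M" "a' \<in> A" "b \<in> B" "e = {a', b}"
    and reach: "\<forall>v \<in> verts ?G. \<exists>P \<subseteq> pruned_edges w ?G M. path_between v b P \<and> alternating M P"
    using clus unfolding bottleneck_cluster_def Let_def by (elim conjE bexE)
  ultimately obtain P where P: "P \<subseteq> pruned_edges w ?G M" "path_between a b P" "alternating M P"
    by blast
  have ab: "a \<noteq> b"
    using a e(3) dis by blast
  obtain vs where vs: "distinct vs" "P = path_edges vs" and len: "Suc 0 < length vs"
    and v0: "vs ! 0 = a" and vl: "vs ! (length vs - 1) = b"
    using path_between_distinctE[OF P(2) ab] by metis
  have e0: "{vs ! 0, vs ! Suc 0} \<notin> M"
    using free v0 by (auto simp: free_vertex_def)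
  \<comment> \<open>As \<open>e\<close> contains the last vertex \<open>b\<close>, it could only be
    the last edge. A path from an agent to a task has odd length, so its last edge has an even index
    and is unmatched like the first.\<close>
  have "e \<notin> P"
  proof
    assume "e \<in> P"
    then obtain k where k: "Suc k < length vs" "e = {vs ! k, vs ! Suc k}"
      using vs(2) by (auto simp: path_edges_def)
    then have "b = vs ! k \<or> b = vs ! Suc k"
      using e(4) by auto
    then have kl: "Suc k = length vs - 1"
      using vl k vs(1) by (auto simp: nth_eq_iff_index_eq)
    have "b \<in> A \<longleftrightarrow> (even (Suc k) \<longleftrightarrow> vs ! 0 \<in> A)"
      using bipartite_path_parity[of vs A B "Suc k"] P(1) sub vs(2) dis k(1) kl vl by auto
    then have "even k"
      using v0 a e(3) dis by auto
    then have "e \<notin> M"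
      using alternating_parityD[of vs M k] vs P(3) k e0 by auto
    then show False
      using e(1) by blast
  qed
  moreover have "alternating (M - {e}) P"
  proof -
    have "P \<inter> (M - {e}) = P \<inter> M" "P - (M - {e}) = P - M"
      using \<open>e \<notin> P\<close> by auto
    then show ?thesis
      using P(3) by (simp add: alternating_def)
  qed
  moreover have "free_vertex (M - {e}) b"
    unfolding free_vertex_def using matching_unique[OF M _ e(1), of _ b] e(4) by blast
  moreover have "free_vertex (M - {e}) a"
    using free by (simp add: free_vertex_def)
  moreover have "1 \<le> card P"
    using card_path_edges_ge_1[OF len] vs(2) by simp
  ultimately have "augmenting_path (M - {e}) P" and "P \<subseteq> pruned_edges w ?G M - {e}"
    using P ab unfolding augmenting_path_def by blast+
  then show False
    using crit unfolding critical_bottleneck_edge_def by blast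
qed

section \<open>Exchanging tasks along a perfect matching\<close>

text \<open>The perfect matching is given by its partner map \<open>m\<close>. A step from \<open>x\<close> to \<open>x'\<close> stands for the
  alternating path \<open>x, m x, x'\<close>, so alternating paths become walks on the agents.\<close>

definition exchange :: "('v set \<Rightarrow> real) \<Rightarrow> real \<Rightarrow> 'v set \<Rightarrow> ('v \<Rightarrow> 'v) \<Rightarrow> ('v \<times> 'v) set" where
  "exchange w t A m = {(x, x'). x \<in> A \<and> x' \<in> A \<and> w {m x, x'} < t}"

fun partner_path :: "('v \<Rightarrow> 'v) \<Rightarrow> 'v list \<Rightarrow> 'v list" where
  "partner_path m [] = []"
| "partner_path m (x # xs) = x # m x # partner_path m xs"

lemma length_partner_path [simp]: "length (partner_path m xs) = 2 * length xs"
  by (induction xs) auto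

lemma set_partner_path [simp]: "set (partner_path m xs) = set xs \<union> m ` set xs"
  by (induction xs) auto

lemma partner_path_nth:
  "k < 2 * length xs \<Longrightarrow>
    partner_path m xs ! k = (if even k then xs ! (k div 2) else m (xs ! (k div 2)))"
proof (induction xs arbitrary: k)
  case (Cons x xs)
  show ?case
  proof (cases "k < 2")
    case True
    then show ?thesis
      by (auto simp: less_2_cases_iff)
  next
    case False
    then obtain l where "k = Suc (Suc l)"
      by (metis add_2_eq_Suc le_Suc_ex not_less)
    then show ?thesis
      using Cons by simp
  qed
qed simp

lemma distinct_partner_path:
  assumes "distinct xs" "inj_on m (set xs)" "set xs \<inter> m ` set xs = {}"
  shows "distinct (partner_path m xs)"
  using assms by (induction xs) auto

text \<open>A light matching edge makes its agent a loop of \<open>exchange\<close>. Thus an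
  exchange step uses an unmatched edge exactly when it changes the agent.\<close>

lemma partner_edge_iff:
  assumes "bij_betw m A B" "A \<inter> B = {}" "x \<in> A" "y \<in> A"
  shows "{m x, y} \<in> (\<lambda>x. {x, m x}) ` A \<longleftrightarrow> x = y"
proof -
  have "m x \<in> B" and "\<And>z. z \<in> A \<Longrightarrow> m z \<in> B"
    using assms(1,3) bij_betwE by blast+
  then have "{m x, y} = {z, m z} \<Longrightarrow> z \<in> A \<Longrightarrow> m x = m z \<and> y = z" for z
    using assms by (auto simp: doubleton_eq_iff)
  then show ?thesis
    using assms inj_onD[OF bij_betw_imp_inj_on[OF assms(1)]] by auto
qed

section \<open>From exchange walks to alternating paths\<close>

text \<open>Paths need distinct vertices. When the new first vertex already occurs, the walk is cut
  back to start at that occurrence.\<close>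

lemma rtrancl_distinct_walk:
  assumes "(x, y) \<in> r\<^sup>*"
  shows "\<exists>xs. xs \<noteq> [] \<and> distinct xs \<and> hd xs = x \<and> last xs = y \<and> successively (\<lambda>a b. (a, b) \<in> r) xs"
  using assms
proof (induction rule: converse_rtrancl_induct)
  case base
  show ?case
    by (rule exI[of _ "[y]"]) simp
next
  case (step x z)
  then obtain xs where xs: "xs \<noteq> []" "distinct xs" "hd xs = z" "last xs = y"
    "successively (\<lambda>a b. (a, b) \<in> r) xs"
    by blast
  show ?case
  proof (cases "x \<in> set xs")
    case True
    then obtain us vs where "xs = us @ x # vs"
      by (meson split_list)
    then show ?thesis
      using xs by (intro exI[of _ "x # vs"]) (auto simp: successively_append_iff)
  next
    case False
    then show ?thesis
      using xs step.hyps(1) by (intro exI[of _ "x # xs"]) (auto simp: successively_Cons)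
  qed
qed

lemma exchange_walk_subset:
  assumes "xs \<noteq> []" "hd xs \<in> A" "successively (\<lambda>a b. (a, b) \<in> exchange w t A m) xs"
  shows "set xs \<subseteq> A"
  using assms by (induction xs rule: induct_list012) (auto simp: exchange_def)

text \<open>This supplies the path of condition (iii). Inserting its partner after each agent of a
  distinct walk gives a path that begins and ends with a matching edge, so matched edges outnumber
  the others by one.\<close>

lemma exchange_walk_partner_path:
  assumes bij: "bij_betw m A B" and dis: "A \<inter> B = {}" and i: "i \<in> A"
    and light: "\<And>x. x \<in> A \<Longrightarrow> w {x, m x} < t"
    and walk: "(i, x) \<in> (exchange w t A m)\<^sup>*"
  defines "M \<equiv> (\<lambda>x. {x, m x}) ` A"
  shows "\<exists>P \<subseteq> edges (complete_bipartite A B). path_between i (m x) P \<and> alternating M P \<and>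
    (\<forall>e\<in>P. w e < t) \<and> card (P - M) < card (P \<inter> M)"
proof -
  obtain xs where xs: "xs \<noteq> []" "distinct xs" "hd xs = i" "last xs = x"
    and suc: "successively (\<lambda>a b. (a, b) \<in> exchange w t A m) xs"
    using rtrancl_distinct_walk[OF walk] by blast
  have xsA: "set xs \<subseteq> A"
    using exchange_walk_subset[OF xs(1) _ suc] xs(3) i by simp
  have mA: "a \<in> A \<Longrightarrow> m a \<in> B" for a
    using bij bij_betwE by blast
  have inj: "inj_on m (set xs)"
    using bij xsA by (meson bij_betw_def inj_on_subset)
  let ?vs = "partner_path m xs" and ?n = "length xs"
  have n: "0 < ?n"
    using xs(1) by simp
  have dvs: "distinct ?vs"
    using distinct_partner_path[OF xs(2) inj] xsA mA dis by blast
  have even_edge: "{?vs ! k, ?vs ! Suc k} = {xs ! (k div 2), m (xs ! (k div 2))}"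
    "xs ! (k div 2) \<in> A" if "Suc k < 2 * ?n" "even k" for k
  proof -
    show "{?vs ! k, ?vs ! Suc k} = {xs ! (k div 2), m (xs ! (k div 2))}"
      using that by (simp add: partner_path_nth)
    have "k div 2 < ?n"
      using that by auto
    then show "xs ! (k div 2) \<in> A"
      using xsA nth_mem by blast
  qed
  have odd_edge: "{?vs ! k, ?vs ! Suc k} = {m (xs ! (k div 2)), xs ! Suc (k div 2)}"
    "(xs ! (k div 2), xs ! Suc (k div 2)) \<in> exchange w t A m"
    "xs ! (k div 2) \<noteq> xs ! Suc (k div 2)" "Suc (k div 2) < ?n"
    if "Suc k < 2 * ?n" "odd k" for k
  proof -
    show "{?vs ! k, ?vs ! Suc k} = {m (xs ! (k div 2)), xs ! Suc (k div 2)}"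
      using that by (simp add: partner_path_nth)
    show lt: "Suc (k div 2) < ?n"
      using that by presburger
    show "(xs ! (k div 2), xs ! Suc (k div 2)) \<in> exchange w t A m"
      using suc lt by (simp add: successively_conv_nth)
    show "xs ! (k div 2) \<noteq> xs ! Suc (k div 2)"
      using xs(2) lt by (simp add: nth_eq_iff_index_eq)
  qed
  \<comment> \<open>Even positions carry the partner edges. Odd ones are unmatched because
    distinctness of the walk rules out loops.\<close>
  have par: "{?vs ! k, ?vs ! Suc k} \<in> M \<longleftrightarrow> even k" if "Suc k < 2 * ?n" for k
  proof (cases "even k")
    case True
    then show ?thesis
      using even_edge[OF that] by (auto simp: M_def)
  next
    case False
    then have "xs ! (k div 2) \<in> A" "xs ! Suc (k div 2) \<in> A"
      using odd_edge(2)[OF that] by (auto simp: exchange_def)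
    then show ?thesis
      using odd_edge(1,3)[OF that] False partner_edge_iff[OF bij dis] by (simp add: M_def)
  qed
  let ?P = "path_edges ?vs"
  have P: "e \<in> ?P \<Longrightarrow> \<exists>k. Suc k < 2 * ?n \<and> e = {?vs ! k, ?vs ! Suc k}" for e
    by (auto simp: path_edges_def)
  have "?P \<subseteq> edges (complete_bipartite A B)"
  proof
    fix e assume "e \<in> ?P"
    then obtain k where k: "Suc k < 2 * ?n" "e = {?vs ! k, ?vs ! Suc k}"
      using P by blast
    have "\<exists>x\<in>A. \<exists>y\<in>A. e = {x, m y}"
    proof (cases "even k")
      case True
      then show ?thesis
        using even_edge[OF k(1)] k(2) by blast
    next
      case False
      then show ?thesis
        using odd_edge(1,2)[OF k(1)] k(2) by (auto simp: exchange_def insert_commute)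
    qed
    then show "e \<in> edges (complete_bipartite A B)"
      using mA by (auto simp: complete_bipartite_edge)
  qed
  moreover have "path_between i (m x) ?P"
    unfolding path_between_def
  proof (intro exI[of _ ?vs] conjI refl)
    show "hd ?vs = i"
      using xs(1,3) by (cases xs) auto
    have vsn: "?vs \<noteq> []"
      using xs(1) by (cases xs) auto
    have "(2 * ?n - 1) div 2 = ?n - 1" "odd (2 * ?n - 1)"
      using n by presburger+
    then show "last ?vs = m x"
      using xs(1,4) n vsn by (simp add: last_conv_nth partner_path_nth)
    show "?vs \<noteq> []"
      by (rule vsn)
  qed (rule dvs)
  moreover have "alternating M ?P"
    using alternating_parityI[OF dvs, of M True] par by simp
  moreover have "\<forall>e\<in>?P. w e < t"
  proof
    fix e assume "e \<in> ?P"
    then obtain k where k: "Suc k < 2 * ?n" "e = {?vs ! k, ?vs ! Suc k}"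
      using P by blast
    show "w e < t"
      using even_edge[OF k(1)] odd_edge[OF k(1)] light k(2)
      by (cases "even k") (auto simp: exchange_def)
  qed
  moreover have "card (?P - M) < card (?P \<inter> M)"
  proof -
    \<comment> \<open>There is at most one unmatched edge for each of the \<open>?n - 1\<close>
      steps, whereas each of the \<open>?n\<close> agents contributes its own matching edge.\<close>
    have "?P - M \<subseteq> (\<lambda>q. {m (xs ! q), xs ! Suc q}) ` {..<?n - 1}"
    proof
      fix e assume e: "e \<in> ?P - M"
      then obtain k where k: "Suc k < 2 * ?n" "e = {?vs ! k, ?vs ! Suc k}"
        using P by blast
      then have "odd k"
        using par e by auto
      then show "e \<in> (\<lambda>q. {m (xs ! q), xs ! Suc q}) ` {..<?n - 1}"
        using odd_edge(1,4)[OF k(1)] k(2) by auto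
    qed
    then have "card (?P - M) \<le> card ((\<lambda>q. {m (xs ! q), xs ! Suc q}) ` {..<?n - 1})"
      by (intro card_mono) auto
    also have "\<dots> \<le> ?n - 1"
      using card_image_le[of "{..<?n - 1}"] by simp
    finally have 1: "card (?P - M) < ?n"
      using n by linarith
    have "(\<lambda>x. {x, m x}) ` set xs \<subseteq> ?P \<inter> M"
    proof
      fix e assume "e \<in> (\<lambda>x. {x, m x}) ` set xs"
      then obtain q where q: "q < ?n" "e = {xs ! q, m (xs ! q)}"
        by (auto simp: in_set_conv_nth)
      then have lt: "Suc (2 * q) < 2 * ?n"
        by simp
      then have "e = {?vs ! (2 * q), ?vs ! Suc (2 * q)}"
        using even_edge(1)[OF lt] q(2) by simp
      then show "e \<in> ?P \<inter> M"
        using par[OF lt] path_edgesI[of "2 * q" ?vs] lt by simp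
    qed
    moreover have "finite (?P \<inter> M)"
      using finite_path_edges by blast
    ultimately have "card ((\<lambda>x. {x, m x}) ` set xs) \<le> card (?P \<inter> M)"
      by (intro card_mono)
    moreover have "inj_on (\<lambda>x. {x, m x}) (set xs)"
      using xsA mA dis by (fastforce simp: inj_on_def doubleton_eq_iff)
    ultimately have "?n \<le> card (?P \<inter> M)"
      using xs(2) by (simp add: card_image distinct_card)
    then show ?thesis
      using 1 by linarith
  qed
  ultimately show ?thesis
    by (intro exI[of _ ?P]) blast
qed

text \<open>A cycle through \<open>a\<close>, opened at the matching edge \<open>e\<close>, is an augmenting path relative to
  \<open>M - {e}\<close>.\<close>

lemma critical_edge_no_exchange_cycle:
  assumes bij: "bij_betw m A B" and dis: "A \<inter> B = {}" and finA: "finite A"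
    and M: "M = (\<lambda>x. {x, m x}) ` A" and a: "a \<in> A"
    and crit: "critical_bottleneck_edge w (complete_bipartite A B) M {a, m a}"
  shows "(a, a) \<notin> (exchange w (w {a, m a}) A m)\<^sup>+"
proof
  let ?G = "complete_bipartite A B" and ?e = "{a, m a}" and ?R = "exchange w (w {a, m a}) A m"
  assume "(a, a) \<in> ?R\<^sup>+"
  then obtain y where y: "(a, y) \<in> ?R\<^sup>*" "(y, a) \<in> ?R"
    by (meson tranclD2)
  obtain zs where zs: "zs \<noteq> []" "distinct zs" "hd zs = a" "last zs = y"
    and suc: "successively (\<lambda>a b. (a, b) \<in> ?R) zs"
    using rtrancl_distinct_walk[OF y(1)] by blast
  have finM: "finite M"
    using M finA by simp
  have max: "Max (w ` M) = w ?e"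
    using crit arg_max_set_Max(2)[OF finM] unfolding critical_bottleneck_edge_def by metis
  have zsA: "set zs \<subseteq> A"
    using exchange_walk_subset[OF zs(1) _ suc] zs(3) a by simp
  have mA: "x \<in> A \<Longrightarrow> m x \<in> B" for x
    using bij bij_betwE by blast
  have inj: "inj_on m (set zs)"
    using bij zsA by (meson bij_betw_def inj_on_subset)
  let ?us = "partner_path m zs" and ?n = "length zs"
  \<comment> \<open>The list \<open>?us\<close> runs from \<open>a, m a\<close> to
    \<open>y, m y\<close>. Rotation moves \<open>a\<close> to the end, which removes the edge
    \<open>?e\<close> and adds the edge of the closing step from \<open>y\<close> to
    \<open>a\<close>.\<close>
  let ?vs = "rotate1 ?us"
  have n: "0 < ?n"
    using zs(1) by simp
  have z0: "zs ! 0 = a" and zl: "zs ! (?n - 1) = y"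
    using zs by (auto simp: hd_conv_nth last_conv_nth)
  have dvs: "distinct ?vs"
    using distinct_partner_path[OF zs(2) inj] zsA mA dis by auto
  have vs_nth: "?vs ! k = ?us ! (Suc k mod (2 * ?n))" if "k < 2 * ?n" for k
    using that by (simp add: nth_rotate1)
  have vs_even: "?vs ! k = m (zs ! (k div 2))" if "k < 2 * ?n" "even k" for k
  proof -
    have "Suc k < 2 * ?n"
      using that by presburger
    then show ?thesis
      using vs_nth[OF that(1)] that by (simp add: partner_path_nth)
  qed
  have vs_odd: "?vs ! k = zs ! (Suc (k div 2) mod ?n)" if k: "k < 2 * ?n" "odd k" for k
  proof -
    obtain q where q: "k = Suc (2 * q)"
      using k(2) by (auto elim: oddE)
    then have "?vs ! k = ?us ! (2 * (Suc q mod ?n))"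
      using vs_nth[OF k(1)] by (simp add: mult_mod_right)
    moreover have "Suc q mod ?n < ?n"
      using n by simp
    ultimately show ?thesis
      using q by (simp add: partner_path_nth)
  qed
  \<comment> \<open>The index is taken modulo \<open>?n\<close> so that the closing step of the
    cycle is treated like the others.\<close>
  have step: "(zs ! q, zs ! (Suc q mod ?n)) \<in> ?R" if "q < ?n" for q
  proof (cases "Suc q < ?n")
    case True
    then show ?thesis
      using suc by (simp add: successively_conv_nth)
  next
    case False
    then have "q = ?n - 1" "Suc q = ?n"
      using that by auto
    then show ?thesis
      using y(2) zl z0 by simp
  qed
  have memM: "{m x, x'} \<in> M \<longleftrightarrow> x = x'" if "x \<in> A" "x' \<in> A" for x x'
    using partner_edge_iff[OF bij dis that] M by simp
  have edge: "{?vs ! k, ?vs ! Suc k} \<in> pruned_edges w ?G M - {?e} \<and>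
      ({?vs ! k, ?vs ! Suc k} \<in> M - {?e} \<longleftrightarrow> odd k)" if "Suc k < 2 * ?n" for k
  proof (cases "even k")
    case True
    let ?q = "k div 2"
    let ?x = "zs ! ?q" and ?x' = "zs ! (Suc ?q mod ?n)"
    have q: "Suc ?q < ?n \<or> Suc ?q = ?n"
      using that True by presburger
    then have "?q < ?n"
      by linarith
    then have R: "(?x, ?x') \<in> ?R"
      by (rule step)
    have vk: "?vs ! k = m ?x" "?vs ! Suc k = ?x'"
      using vs_even[of k] vs_odd[of "Suc k"] True that by auto
    \<comment> \<open>By distinctness a loop can occur only when \<open>?n = 1\<close>. It would
      then sit at \<open>a\<close> and require \<open>w ?e < w ?e\<close>.\<close>
    have "?x \<noteq> ?x'"
    proof
      assume "?x = ?x'"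
      then have "?q = Suc ?q mod ?n"
        using zs(2) q n by (subst (asm) nth_eq_iff_index_eq) auto
      then have "?q = 0" "?n = 1"
        using q by auto
      then have "?x = a" "?x' = a"
        using z0 by auto
      then show False
        using R by (simp add: exchange_def insert_commute)
    qed
    moreover have "?x \<in> A" "?x' \<in> A" "w {m ?x, ?x'} < w ?e"
      using R by (auto simp: exchange_def)
    moreover from this have "{m ?x, ?x'} \<in> edges ?G"
      using mA complete_bipartite_edge insert_commute by metis
    moreover have "?e \<in> M"
      using M a by blast
    ultimately have "{m ?x, ?x'} \<notin> M" "{m ?x, ?x'} \<in> pruned_edges w ?G M" "{m ?x, ?x'} \<noteq> ?e"
      unfolding pruned_edges_def max using memM by (blast, blast, metis)
    then show ?thesis
      using vk True by simp
  next
    case False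
    let ?x = "zs ! Suc (k div 2)"
    have q: "Suc (k div 2) < ?n"
      using that False by presburger
    have vk: "?vs ! k = ?x" "?vs ! Suc k = m ?x"
      using vs_odd[of k] vs_even[of "Suc k"] False that q by auto
    have xA: "?x \<in> A"
      using q zsA nth_mem by blast
    have "?x \<noteq> zs ! 0"
      using zs(2) q n by (subst nth_eq_iff_index_eq) auto
    then have "{?x, m ?x} \<noteq> ?e"
      using z0 xA mA[OF a] dis by (auto simp: doubleton_eq_iff)
    moreover have "{?x, m ?x} \<in> M"
      using M xA by blast
    ultimately show ?thesis
      using vk False by (simp add: pruned_edges_def)
  qed
  let ?P = "path_edges ?vs"
  have sub: "?P \<subseteq> pruned_edges w ?G M - {?e}"
    using edge by (auto simp: path_edges_def)
  have free: "free_vertex (M - {?e}) a" "free_vertex (M - {?e}) (m a)"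
    using mA a dis bij_betw_imp_inj_on[OF bij]
    by (auto simp: free_vertex_def M dest: inj_onD)
  have "path_between (m a) a ?P"
    unfolding path_between_def
  proof (intro exI[of _ ?vs] conjI refl)
    show vsn: "?vs \<noteq> []"
      using n by (metis length_0_conv length_partner_path length_rotate1 mult_is_0 not_gr0 zero_neq_numeral)
    show "hd ?vs = m a"
      using vs_even[of 0] n z0 vsn by (simp add: hd_conv_nth)
    have "Suc ((2 * ?n - 1) div 2) = ?n" "odd (2 * ?n - 1)"
      using n by presburger+
    then show "last ?vs = a"
      using vs_odd[of "2 * ?n - 1"] n z0 vsn by (simp add: last_conv_nth)
  qed (rule dvs)
  moreover have "alternating (M - {?e}) ?P"
  \<comment> \<open>The opened cycle starts with the unmatched edge of the first step, hence
    \<open>c = False\<close>.\<close>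
  proof (rule alternating_parityI[OF dvs, where c = False])
    fix k assume "Suc k < length ?vs"
    then have "{?vs ! k, ?vs ! Suc k} \<in> M - {?e} \<longleftrightarrow> odd k"
      by (intro conjunct2[OF edge]) simp
    then show "{?vs ! k, ?vs ! Suc k} \<in> M - {?e} \<longleftrightarrow> (even k \<longleftrightarrow> False)"
      by blast
  qed
  moreover have "1 \<le> card ?P"
    using n by (intro card_path_edges_ge_1) (unfold length_rotate1 length_partner_path, linarith)
  moreover have "m a \<noteq> a"
    using mA[OF a] a dis by auto
  ultimately have "augmenting_path (M - {?e}) ?P"
    using free unfolding augmenting_path_def by blast
  then show False
    using crit sub unfolding critical_bottleneck_edge_def by blast
qed

section \<open>From alternating paths and trees to exchange walks\<close>

text \<open>For a bijective partner map \<open>m\<close>, both ends of a matching edge are sent to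
  its agent. Matching edges thereby shrink to points and alternating paths project to walks on
  agents.\<close>

definition agent_of :: "'v set \<Rightarrow> ('v \<Rightarrow> 'v) \<Rightarrow> 'v \<Rightarrow> 'v" where
  "agent_of A m v = (if v \<in> A then v else inv_into A m v)"

text \<open>The unmatched edges have even index, so by bipartiteness all are traversed in the same
  direction. Going from task to agent is an exchange step and going from agent to task a reversed
  one, hence the converse for a path that starts at an agent. The unmatched first edge contributes a
  genuine step, hence the transitive closure.\<close>

lemma alternating_path_exchange:
  assumes bij: "bij_betw m A B" and dis: "A \<inter> B = {}" and M: "M = (\<lambda>x. {x, m x}) ` A"
    and vs: "distinct vs" "alternating M (path_edges vs)"
    and light: "path_edges vs \<subseteq> edges (complete_bipartite A B)" "\<And>e. e \<in> path_edges vs - M \<Longrightarrow> w e < t"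
    and k: "0 < k" "k < length vs" and start: "{vs ! 0, vs ! Suc 0} \<notin> M"
  shows "(agent_of A m (vs ! 0), agent_of A m (vs ! k)) \<in>
    (if vs ! 0 \<in> A then (exchange w t A m)\<inverse> else exchange w t A m)\<^sup>+" (is "_ \<in> ?Q\<^sup>+")
proof -
  let ?g = "agent_of A m"
  have gA: "x \<in> A \<Longrightarrow> ?g x = x" for x
    by (simp add: agent_of_def)
  have inv: "y \<in> B \<Longrightarrow> ?g y \<in> A \<and> m (?g y) = y" for y
    using bij dis by (auto simp: agent_of_def bij_betw_def f_inv_into_f inv_into_into)
  have gm: "x \<in> A \<Longrightarrow> ?g (m x) = x" for x
    using bij dis bij_betwE[OF bij] by (auto simp: agent_of_def bij_betw_def inv_into_f_f)
  have step: "if even k then (?g (vs ! k), ?g (vs ! Suc k)) \<in> ?Q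
      else ?g (vs ! k) = ?g (vs ! Suc k)" if lt: "Suc k < length vs" for k
  proof -
    let ?e = "{vs ! k, vs ! Suc k}"
    have e: "?e \<in> path_edges vs"
      using path_edgesI[OF lt] .
    have par: "?e \<in> M \<longleftrightarrow> odd k"
      using alternating_parityD[OF vs lt] start by simp
    have sides: "vs ! k \<in> A \<and> vs ! Suc k \<in> B \<or> vs ! k \<in> B \<and> vs ! Suc k \<in> A"
      using bipartite_path_step[OF light(1) lt] .
    show ?thesis
    proof (cases "even k")
      case True
      then have we: "w ?e < t"
        using light(2) par e by blast
      have kA: "vs ! k \<in> A \<longleftrightarrow> vs ! 0 \<in> A"
        using bipartite_path_parity[OF light(1) dis, of k] lt True by simp
      show ?thesis
      proof (cases "vs ! k \<in> A")
        case kin: True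
        then have "vs ! Suc k \<in> B"
          using sides dis by blast
        then have "(?g (vs ! Suc k), vs ! k) \<in> exchange w t A m"
          using inv kin we by (simp add: exchange_def insert_commute)
        then show ?thesis
          using True kin kA gA by simp
      next
        case False
        then have "vs ! k \<in> B" "vs ! Suc k \<in> A"
          using sides by auto
        then have "(?g (vs ! k), vs ! Suc k) \<in> exchange w t A m"
          using inv we by (simp add: exchange_def)
        then show ?thesis
          using True False kA gA \<open>vs ! Suc k \<in> A\<close> by simp
      qed
    next
      case False
      then obtain x where "x \<in> A" "?e = {x, m x}"
        using par M by auto
      then have "?g (vs ! k) = x \<and> ?g (vs ! Suc k) = x"
        using gA gm by (auto simp: doubleton_eq_iff)
      then show ?thesis
        using False by simp
    qed
  qed
  have "0 < k \<longrightarrow> (?g (vs ! 0), ?g (vs ! k)) \<in> ?Q\<^sup>+"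
    using k(2)
  proof (induction k)
    case (Suc k)
    show ?case
    proof (cases "k = 0")
      case True
      then have "(?g (vs ! 0), ?g (vs ! Suc k)) \<in> ?Q"
        using step[OF Suc.prems] by (simp split del: if_split)
      then show ?thesis
        by (simp split del: if_split)
    next
      case False
      then have IH: "(?g (vs ! 0), ?g (vs ! k)) \<in> ?Q\<^sup>+"
        using Suc by (simp split del: if_split)
      have "(?g (vs ! k), ?g (vs ! Suc k)) \<in> ?Q\<^sup>*"
      proof (cases "even k")
        case True
        then have "(?g (vs ! k), ?g (vs ! Suc k)) \<in> ?Q"
          using step[OF Suc.prems] by (simp split del: if_split)
        then show ?thesis
          by (rule r_into_rtrancl)
      next
        case False
        then have "?g (vs ! k) = ?g (vs ! Suc k)"
          using step[OF Suc.prems] by (simp split del: if_split)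
        then show ?thesis
          by simp
      qed
      then show ?thesis
        using trancl_rtrancl_trancl[OF IH] by blast
    qed
  qed simp
  then show ?thesis
    using k(1) by blast
qed

lemma alternating_tree_exchange:
  assumes bij: "bij_betw m A B" and dis: "A \<inter> B = {}" and M: "M = (\<lambda>x. {x, m x}) ` A"
    and tree: "alternating_tree M r T"
    and sub: "edges T \<subseteq> pruned_edges w (complete_bipartite A B) M"
    and root: "\<And>e. e \<in> edges T \<Longrightarrow> r \<in> e \<Longrightarrow> e \<notin> M"
    and v: "v \<in> verts T" "v \<noteq> r"
  shows "(agent_of A m r, agent_of A m v) \<in>
    (if r \<in> A then (exchange w (Max (w ` M)) A m)\<inverse> else exchange w (Max (w ` M)) A m)\<^sup>+"
proof -
  have "\<exists>P \<subseteq> edges T. path_between r v P"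
    using tree v unfolding alternating_tree_def tree_def connected_graph_def by blast
  then obtain P where P: "P \<subseteq> edges T" "path_between r v P"
    by blast
  then have alt: "alternating M P"
    using tree v unfolding alternating_tree_def by blast
  obtain vs where vs: "distinct vs" "P = path_edges vs" and len: "Suc 0 < length vs"
    and v0: "vs ! 0 = r" and vl: "vs ! (length vs - 1) = v"
    using path_between_distinctE[OF P(2)] v(2) by metis
  have "{vs ! 0, vs ! Suc 0} \<notin> M"
    using root path_edgesI[OF len] P(1) vs(2) v0 by blast
  moreover have "M \<subseteq> edges (complete_bipartite A B)"
    unfolding M using bij_betwE[OF bij] by (fastforce simp: complete_bipartite_edge)
  then have "path_edges vs \<subseteq> edges (complete_bipartite A B)"
    using pruned_edges_subset sub P(1) vs(2) by blast
  moreover have "w e < Max (w ` M)" if "e \<in> path_edges vs - M" for e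
    using that sub P(1) vs(2) by (auto simp: pruned_edges_def)
  ultimately show ?thesis
    using alternating_path_exchange[OF bij dis M vs(1), of w "Max (w ` M)" "length vs - 1"]
      alt len unfolding v0 vl vs(2) by (simp split del: if_split)
qed

text \<open>Maximum cardinality saturates the tasks; criticality and the cluster property saturate
  the agents.\<close>

lemma bottleneck_cluster_partner:
  assumes "finite A" "finite B" "A \<inter> B = {}" "card B \<le> card A"
    and crit: "critical_bottleneck_edge w (complete_bipartite A B) M e"
    and clus: "bottleneck_cluster w A B M e"
  obtains m where "bij_betw m A B" "M = (\<lambda>x. {x, m x}) ` A"
proof (rule perfect_matching_partner[OF assms(1-3)])
  have "mcm (complete_bipartite A B) M"
    using crit by (simp add: critical_bottleneck_edge_def)
  then show "matching (complete_bipartite A B) M" "card M = card B"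
    using mcm_complete_bipartite_iff[OF assms(1-4)] by blast+
  show "\<not> free_vertex M x" if "x \<in> A" for x
    using bottleneck_cluster_no_free_agent[OF assms(3) that crit clus] .
qed

text \<open>The trees become reachability statements: walks lead from the agents belonging to
  vertices of \<open>S\<close> to \<open>a\<close>, and from \<open>a\<close> to those belonging to
  vertices of \<open>T\<close>. The trees are disjoint and the ends of the critical edge are their
  two roots, so no tree edge at a root is matched.\<close>

lemma tree_decomposition_exchange:
  assumes bij: "bij_betw m A B" and dis: "A \<inter> B = {}" and M: "M = (\<lambda>x. {x, m x}) ` A"
    and a: "a \<in> A" and dec: "tree_decomposition w A B M {a, m a} S T"
  shows "a \<in> verts S" "m a \<in> verts T" "verts S \<union> verts T = A \<union> B" "verts S \<inter> verts T = {}"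
    and "\<And>v. v \<in> verts S \<Longrightarrow> v \<noteq> a \<Longrightarrow>
      (agent_of A m v, a) \<in> (exchange w (Max (w ` M)) A m)\<^sup>+"
    and "\<And>v. v \<in> verts T \<Longrightarrow> (a, agent_of A m v) \<in> (exchange w (Max (w ` M)) A m)\<^sup>*"
proof -
  let ?G = "complete_bipartite A B" and ?R = "exchange w (Max (w ` M)) A m"
  have ma: "m a \<in> B"
    using a bij_betwE[OF bij] by blast
  obtain a' b' where ab: "a' \<in> A" "b' \<in> B" "{a, m a} = {a', b'}" "a' \<in> verts S" "b' \<in> verts T"
    and trees: "alternating_tree M a' S" "alternating_tree M b' T"
    using dec unfolding tree_decomposition_def Let_def by blast
  have eq: "a' = a" "b' = m a"
    using ab a ma dis by (auto simp: doubleton_eq_iff)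
  show aS: "a \<in> verts S" and maT: "m a \<in> verts T"
    using ab eq by auto
  show cover: "verts S \<union> verts T = A \<union> B" and disj: "verts S \<inter> verts T = {}"
    using dec by (auto simp: tree_decomposition_def Let_def complete_bipartite_def)
  have sub: "edges S \<subseteq> pruned_edges w ?G M" "edges T \<subseteq> pruned_edges w ?G M"
    and gr: "graph S" "graph T"
    using dec by (auto simp: tree_decomposition_def Let_def subgraph_def)
  have maA: "m a \<notin> A"
    using ma dis by blast
  have agent: "agent_of A m a = a" "agent_of A m (m a) = a"
    using a maA bij by (auto simp: agent_of_def bij_betw_def inv_into_f_f)
  \<comment> \<open>The critical edge is the only matching edge at either root. As a tree edge it
    would put both roots into one tree.\<close>
  have eM: "e = {a, m a}" if e: "e \<in> M" "a \<in> e \<or> m a \<in> e" for e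
  proof -
    obtain x where x: "x \<in> A" "e = {x, m x}"
      using e(1) M by blast
    then have "x = a \<or> m x = m a"
      using e(2) a maA bij_betwE[OF bij] dis by auto
    then have "x = a"
      using x(1) a inj_onD[OF bij_betw_imp_inj_on[OF bij]] by blast
    then show ?thesis
      using x(2) by simp
  qed
  show "(agent_of A m v, a) \<in> ?R\<^sup>+" if "v \<in> verts S" "v \<noteq> a" for v
  proof -
    have "e \<notin> M" if e: "e \<in> edges S" "a \<in> e" for e
    proof
      assume "e \<in> M"
      then have "e = {a, m a}"
        using eM e(2) by blast
      then have "m a \<in> verts S"
        using e(1) gr(1) unfolding graph_def by blast
      then show False
        using maT disj by blast
    qed
    then have "(a, agent_of A m v) \<in> (?R\<inverse>)\<^sup>+"
      using alternating_tree_exchange[OF bij dis M trees(1) sub(1)] that a agent eq by simp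
    then show ?thesis
      by (simp add: trancl_converse)
  qed
  show "(a, agent_of A m v) \<in> ?R\<^sup>*" if v: "v \<in> verts T" for v
  proof (cases "v = m a")
    case True
    then show ?thesis
      using agent by simp
  next
    case False
    have "e \<notin> M" if e: "e \<in> edges T" "m a \<in> e" for e
    proof
      assume "e \<in> M"
      then have "e = {a, m a}"
        using eM e(2) by blast
      then have "a \<in> verts T"
        using e(1) gr(2) unfolding graph_def by blast
      then show False
        using aS disj by blast
    qed
    then have "(a, agent_of A m v) \<in> ?R\<^sup>+"
      using alternating_tree_exchange[OF bij dis M trees(2) sub(2)] v False maA agent eq by simp
    then show ?thesis
      by (rule trancl_into_rtrancl)
  qed
qed

section \<open>Uniting the two clusters\<close>

theorem corollary3:
  fixes A\<^sub>1 A\<^sub>2 B\<^sub>1 B\<^sub>2 :: "'v set"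
    and w :: "'v set \<Rightarrow> real"
    and M\<^sub>1 M\<^sub>2 :: "'v set set"
    and e\<^sub>1 e\<^sub>2 :: "'v set"
    and S\<^sub>\<mu> S\<^sub>\<nu> :: "'v graph"
  assumes "finite A\<^sub>1" "finite A\<^sub>2" "finite B\<^sub>1" "finite B\<^sub>2"
    and "A\<^sub>1 \<noteq> {}" "A\<^sub>2 \<noteq> {}" "B\<^sub>1 \<noteq> {}" "B\<^sub>2 \<noteq> {}"
    and "A\<^sub>1 \<inter> A\<^sub>2 = {}" "A\<^sub>1 \<inter> B\<^sub>1 = {}" "A\<^sub>1 \<inter> B\<^sub>2 = {}"
        "A\<^sub>2 \<inter> B\<^sub>1 = {}" "A\<^sub>2 \<inter> B\<^sub>2 = {}" "B\<^sub>1 \<inter> B\<^sub>2 = {}"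
    and "card A\<^sub>1 \<ge> card B\<^sub>1" "card A\<^sub>2 \<ge> card B\<^sub>2"
    and "bot_solution w (complete_bipartite A\<^sub>1 B\<^sub>1) M\<^sub>1"
    and "bot_solution w (complete_bipartite A\<^sub>2 B\<^sub>2) M\<^sub>2"
    and "e\<^sub>1 \<in> arg_max_set w M\<^sub>1" "e\<^sub>2 \<in> arg_max_set w M\<^sub>2"
    and "critical_bottleneck_edge w (complete_bipartite A\<^sub>1 B\<^sub>1) M\<^sub>1 e\<^sub>1"
    and "critical_bottleneck_edge w (complete_bipartite A\<^sub>2 B\<^sub>2) M\<^sub>2 e\<^sub>2"
    and "bottleneck_cluster w A\<^sub>1 B\<^sub>1 M\<^sub>1 e\<^sub>1" "bottleneck_cluster w A\<^sub>2 B\<^sub>2 M\<^sub>2 e\<^sub>2"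
    and "tree_decomposition w A\<^sub>1 B\<^sub>1 M\<^sub>1 e\<^sub>1 S\<^sub>\<mu> S\<^sub>\<nu>"
    and "w e\<^sub>1 > w e\<^sub>2"
    and "is_singleton (arg_max_set w M\<^sub>1)"
    and "\<not> (\<exists>i \<in> A\<^sub>2. \<exists>j \<in> B\<^sub>2.
            (\<exists>b' \<in> verts S\<^sub>\<nu> \<inter> B\<^sub>1. w {i, b'} < w e\<^sub>1) \<and>
            (\<exists>a' \<in> verts S\<^sub>\<mu> \<inter> A\<^sub>1. w {a', j} < w e\<^sub>1) \<and>
            (\<exists>P \<subseteq> edges (complete_bipartite (A\<^sub>1 \<union> A\<^sub>2) (B\<^sub>1 \<union> B\<^sub>2)).
               path_between i j P \<and> alternating M\<^sub>2 P \<and> (\<forall>e \<in> P. w e < w e\<^sub>1) \<and>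
               card (P \<inter> M\<^sub>2) > card (P - M\<^sub>2)))"
  shows "bot_solution w (complete_bipartite (A\<^sub>1 \<union> A\<^sub>2) (B\<^sub>1 \<union> B\<^sub>2)) (M\<^sub>1 \<union> M\<^sub>2)"
proof -
  note fin = assms(1-4) and dis = assms(9-14) and crit1 = assms(21) and dec = assms(25)
  let ?G = "complete_bipartite (A\<^sub>1 \<union> A\<^sub>2) (B\<^sub>1 \<union> B\<^sub>2)" and ?t = "w e\<^sub>1"
  obtain m1 where bij1: "bij_betw m1 A\<^sub>1 B\<^sub>1" and M1: "M\<^sub>1 = (\<lambda>x. {x, m1 x}) ` A\<^sub>1"
    using bottleneck_cluster_partner[OF assms(1,3,10,15,21,23)] by blast
  obtain m2 where bij2: "bij_betw m2 A\<^sub>2 B\<^sub>2" and M2: "M\<^sub>2 = (\<lambda>x. {x, m2 x}) ` A\<^sub>2"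
    using bottleneck_cluster_partner[OF assms(2,4,13,16,22,24)] by blast
  have finM: "finite M\<^sub>1" "finite M\<^sub>2"
    using M1 M2 fin by auto
  have e1: "e\<^sub>1 \<in> M\<^sub>1" "Max (w ` M\<^sub>1) = ?t"
    using arg_max_set_Max[OF finM(1) assms(19)] by auto
  obtain a where a: "a \<in> A\<^sub>1" "e\<^sub>1 = {a, m1 a}"
    using e1(1) M1 by blast
  \<comment> \<open>This is where \<open>w e\<^sub>1 > w e\<^sub>2\<close> enters. It makes the
    matching edges on walks in the second graph light enough for condition (iii).\<close>
  have light2: "w e < ?t" if "e \<in> M\<^sub>2" for e
    using arg_max_set_Max(2)[OF finM(2) assms(20)] assms(26) that finM(2)
    by (metis Max_ge finite_imageI imageI order_le_less_trans)
  have light1: "w e \<le> ?t" if "e \<in> M\<^sub>1" for e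
    using e1(2) that finM(1) by (metis Max_ge finite_imageI imageI)
  have m1B: "x \<in> A\<^sub>1 \<Longrightarrow> m1 x \<in> B\<^sub>1" and m2B: "x \<in> A\<^sub>2 \<Longrightarrow> m2 x \<in> B\<^sub>2" for x
    using bij1 bij2 bij_betwE by blast+
  have fin3: "finite (A\<^sub>1 \<union> A\<^sub>2)" "finite (B\<^sub>1 \<union> B\<^sub>2)" "(A\<^sub>1 \<union> A\<^sub>2) \<inter> (B\<^sub>1 \<union> B\<^sub>2) = {}"
    using fin dis by auto
  have card3: "card (B\<^sub>1 \<union> B\<^sub>2) \<le> card (A\<^sub>1 \<union> A\<^sub>2)"
    using fin dis assms(15,16) by (simp add: card_Un_disjoint)
  note mcm3 = mcm_complete_bipartite_iff[OF fin3 card3]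
  have max3: "Max (w ` (M\<^sub>1 \<union> M\<^sub>2)) = ?t"
  proof (rule Max_eqI)
    show "finite (w ` (M\<^sub>1 \<union> M\<^sub>2))"
      using finM by simp
    show "?t \<in> w ` (M\<^sub>1 \<union> M\<^sub>2)"
      using e1(1) by blast
    show "y \<le> ?t" if "y \<in> w ` (M\<^sub>1 \<union> M\<^sub>2)" for y
      using that light1 light2 less_imp_le by blast
  qed
  have mcm12: "matching (complete_bipartite A\<^sub>1 B\<^sub>1) M\<^sub>1" "card M\<^sub>1 = card B\<^sub>1"
    "matching (complete_bipartite A\<^sub>2 B\<^sub>2) M\<^sub>2" "card M\<^sub>2 = card B\<^sub>2"
    using assms(21,22) mcm_complete_bipartite_iff[OF assms(1,3,10,15)]
      mcm_complete_bipartite_iff[OF assms(2,4,13,16)]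
    by (auto simp: critical_bottleneck_edge_def)
  have sub: "e \<in> M\<^sub>1 \<Longrightarrow> e \<subseteq> A\<^sub>1 \<union> B\<^sub>1" "e \<in> M\<^sub>2 \<Longrightarrow> e \<subseteq> A\<^sub>2 \<union> B\<^sub>2" for e
    using M1 M2 m1B m2B by auto
  have mcm: "mcm ?G (M\<^sub>1 \<union> M\<^sub>2)"
    unfolding mcm3
  proof
    have "M\<^sub>1 \<inter> M\<^sub>2 = {}"
    proof (rule ccontr)
      assume "M\<^sub>1 \<inter> M\<^sub>2 \<noteq> {}"
      then obtain e where e: "e \<in> M\<^sub>1" "e \<in> M\<^sub>2"
        by blast
      then have "e \<noteq> {}"
        using M1 by auto
      then show False
        using sub(1)[OF e(1)] sub(2)[OF e(2)] dis by blast
    qed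
    then show "card (M\<^sub>1 \<union> M\<^sub>2) = card (B\<^sub>1 \<union> B\<^sub>2)"
      using finM fin dis mcm12 by (simp add: card_Un_disjoint)
    show "matching ?G (M\<^sub>1 \<union> M\<^sub>2)"
      unfolding matching_def
    proof
      have "M\<^sub>1 \<subseteq> edges ?G" "M\<^sub>2 \<subseteq> edges ?G"
        using M1 M2 m1B m2B by (fastforce simp: complete_bipartite_edge)+
      then show "M\<^sub>1 \<union> M\<^sub>2 \<subseteq> edges ?G"
        by blast
      show "\<forall>v. \<exists>\<^sub>\<le>\<^sub>1 e. e \<in> M\<^sub>1 \<union> M\<^sub>2 \<and> v \<in> e"
      proof (intro allI Uniq_I)
        fix v e f
        assume ef: "e \<in> M\<^sub>1 \<union> M\<^sub>2 \<and> v \<in> e" "f \<in> M\<^sub>1 \<union> M\<^sub>2 \<and> v \<in> f"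
        show "e = f"
        proof (cases "v \<in> A\<^sub>1 \<union> B\<^sub>1")
          case True
          then have "e \<in> M\<^sub>1" "f \<in> M\<^sub>1"
            using ef sub(2) dis by blast+
          then show ?thesis
            using matching_unique[OF mcm12(1)] ef by blast
        next
          case False
          then have "e \<in> M\<^sub>2" "f \<in> M\<^sub>2"
            using ef sub(1) by blast+
          then show ?thesis
            using matching_unique[OF mcm12(3)] ef by blast
        qed
      qed
    qed
  qed
  \<comment> \<open>By \<open>max3\<close> the bottleneck of the union is \<open>?t\<close>, so only
    a strictly better matching could spoil minimality.\<close>
  have "\<not> Max (w ` N) < ?t" if N: "mcm ?G N" for N
  proof
    assume less: "Max (w ` N) < ?t"
    have matN: "matching ?G N" and cardN: "card N = card (B\<^sub>1 \<union> B\<^sub>2)"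
      using N mcm3 by auto
    have finN: "finite N"
      using matching_saturation(1)[OF fin3 matN] .
    obtain n where injn: "inj_on n (B\<^sub>1 \<union> B\<^sub>2)" and nA: "n ` (B\<^sub>1 \<union> B\<^sub>2) \<subseteq> A\<^sub>1 \<union> A\<^sub>2"
      and nN: "\<forall>y\<in>B\<^sub>1 \<union> B\<^sub>2. {n y, y} \<in> N"
      using matching_saturation(3)[OF fin3 matN cardN] by blast
    have wn: "w {n y, y} < ?t" if "y \<in> B\<^sub>1 \<union> B\<^sub>2" for y
      using nN that finN less by (metis Max_ge finite_imageI imageI order_le_less_trans)
    let ?R1 = "exchange w ?t A\<^sub>1 m1" and ?R2 = "exchange w ?t A\<^sub>2 m2"
    note tree = tree_decomposition_exchange[OF bij1 assms(10) M1 a(1) dec[unfolded a(2)],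
        folded a(2), unfolded e1(2)]
    have nocycle: "(a, a) \<notin> ?R1\<^sup>+"
      using critical_edge_no_exchange_cycle[OF bij1 assms(10,1) M1 a(1)] crit1 a(2) by simp
    define I where "I = {i \<in> A\<^sub>2. \<exists>b'\<in>verts S\<^sub>\<nu> \<inter> B\<^sub>1. w {i, b'} < ?t}"
    \<comment> \<open>A task of the second graph counts as reached when its agent is reached in
      \<open>?R2\<close>. The reflexive closure includes the partners of the agents in
      \<open>I\<close> themselves.\<close>
    define S where "S = verts S\<^sub>\<nu> \<inter> B\<^sub>1 \<union> {m2 x | x. x \<in> A\<^sub>2 \<and> (\<exists>i\<in>I. (i, x) \<in> ?R2\<^sup>*)}"
    \<comment> \<open>On all agents of the union, \<open>m3\<close> is the partner map of
      \<open>M\<^sub>1 \<union> M\<^sub>2\<close>.\<close>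
    define m3 where "m3 x = (if x \<in> A\<^sub>1 then m1 x else m2 x)" for x
    have SB: "S \<subseteq> B\<^sub>1 \<union> B\<^sub>2"
      using m2B by (auto simp: S_def)
    \<comment> \<open>If \<open>m1 x\<close> lay in \<open>S\<^sub>\<mu>\<close>, the walk from
      \<open>a\<close> to \<open>x\<close> given by one tree and the walk from \<open>x\<close> to
      \<open>a\<close> given by the other would form a forbidden cycle. The task \<open>m1 a\<close>
      is missed because \<open>a\<close> is not in \<open>S\<^sub>\<nu>\<close>.\<close>
    have stay: "m1 x \<in> S - {m1 a}" if x: "x \<in> A\<^sub>1" "x \<in> verts S\<^sub>\<nu>" for x
    proof -
      have xa: "x \<noteq> a"
        using x(2) tree(1,4) by blast
      have agent: "agent_of A\<^sub>1 m1 x = x" "agent_of A\<^sub>1 m1 (m1 x) = x"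
        using x(1) m1B[OF x(1)] assms(10) bij1
        by (auto simp: agent_of_def bij_betw_def inv_into_f_f)
      have ax: "(a, x) \<in> ?R1\<^sup>*"
        using tree(6)[OF x(2)] agent by simp
      have "m1 x \<notin> verts S\<^sub>\<mu>"
      proof
        assume "m1 x \<in> verts S\<^sub>\<mu>"
        moreover have "m1 x \<noteq> a"
          using m1B[OF x(1)] a(1) assms(10) by blast
        ultimately have "(x, a) \<in> ?R1\<^sup>+"
          using tree(5)[of "m1 x"] unfolding agent by blast
        then show False
          using rtrancl_trancl_trancl[OF ax] nocycle by blast
      qed
      then have "m1 x \<in> S"
        using m1B[OF x(1)] tree(3) by (auto simp: S_def)
      moreover have "m1 x \<noteq> m1 a"
        using xa x(1) a(1) inj_onD[OF bij_betw_imp_inj_on[OF bij1]] by blast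
      ultimately show ?thesis
        by blast
    qed
    \<comment> \<open>The steps \<open>m3 \<circ> n\<close> follow the edges of \<open>N\<close> and \<open>M\<^sub>1 \<union> M\<^sub>2\<close> in turn; as no
      pair satisfies (i)--(iii), they never reach an agent of \<open>S\<^sub>\<mu>\<close>.\<close>
    have closed: "m3 (n y) \<in> S - {m1 a}" if y: "y \<in> S" for y
    proof -
      have yB: "y \<in> B\<^sub>1 \<union> B\<^sub>2"
        using y SB by blast
      note wy = wn[OF yB]
      have m1a: "m2 x \<noteq> m1 a" if "x \<in> A\<^sub>2" for x
        using m2B[OF that] m1B[OF a(1)] dis(6) by (metis disjoint_iff)
      from y consider (tree) "y \<in> verts S\<^sub>\<nu>" "y \<in> B\<^sub>1"
        | (walk) i x where "i \<in> I" "x \<in> A\<^sub>2" "(i, x) \<in> ?R2\<^sup>*" "y = m2 x"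
        by (auto simp: S_def)
      then show ?thesis
      proof cases
        case tree_case: tree
        show ?thesis
        proof (cases "n y \<in> A\<^sub>1")
          case True
          obtain x0 where x0: "x0 \<in> A\<^sub>1" "y = m1 x0"
            using tree_case(2) bij1 by (auto simp: bij_betw_def)
          have "agent_of A\<^sub>1 m1 y = x0"
            using x0 tree_case(2) assms(10) bij1
            by (auto simp: agent_of_def bij_betw_def inv_into_f_f)
          then have "(a, x0) \<in> ?R1\<^sup>*"
            using tree(6)[OF tree_case(1)] by simp
          moreover have "(x0, n y) \<in> ?R1"
            using x0 True wy by (simp add: exchange_def insert_commute)
          ultimately have an: "(a, n y) \<in> ?R1\<^sup>+"
            by (rule rtrancl_into_trancl1)
          \<comment> \<open>The light edge \<open>{n y, y}\<close> of \<open>N\<close> prolongs the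
            walk from \<open>a\<close> to \<open>n y\<close>. An agent of
            \<open>S\<^sub>\<mu>\<close> is \<open>a\<close> itself or leads back to it, so the
            cycle would close.\<close>
          have "n y \<notin> verts S\<^sub>\<mu>"
          proof
            assume "n y \<in> verts S\<^sub>\<mu>"
            moreover have "n y \<noteq> a"
              using an nocycle by auto
            moreover have "agent_of A\<^sub>1 m1 (n y) = n y"
              using True by (simp add: agent_of_def)
            ultimately have "(n y, a) \<in> ?R1\<^sup>+"
              using tree(5)[of "n y"] by simp
            then show False
              using trancl_trans[OF an] nocycle by blast
          qed
          then have "n y \<in> verts S\<^sub>\<nu>"
            using True tree(3) by blast
          then show ?thesis
            using stay True by (simp add: m3_def)
        next
          case False
          then have n2: "n y \<in> A\<^sub>2"
            using nA yB by blast
          \<comment> \<open>The task \<open>y\<close> itself witnesses (i) for \<open>n y\<close>,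
            whose partner then enters \<open>S\<close> by the empty walk.\<close>
          then have "n y \<in> I"
            using tree_case wy by (auto simp: I_def)
          then show ?thesis
            using n2 False m1a by (auto simp: m3_def S_def)
        qed
      next
        case walk
        show ?thesis
        proof (cases "n y \<in> A\<^sub>1")
          case True
          \<comment> \<open>Otherwise \<open>n y\<close> would be the agent \<open>a'\<close> of
            (ii) for the task \<open>y\<close>. Since \<open>i\<close> satisfies (i) and the walk
            from \<open>i\<close> to \<open>x\<close> yields the path of (iii), the pair
            \<open>i\<close>, \<open>y\<close> would be one of those excluded by hypothesis.\<close>
          have "n y \<notin> verts S\<^sub>\<mu>"
          proof
            assume mu: "n y \<in> verts S\<^sub>\<mu>"
            have iA: "i \<in> A\<^sub>2"
              using walk(1) by (simp add: I_def)
            have "w {x, m2 x} < ?t" if "x \<in> A\<^sub>2" for x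
              using light2 M2 that by blast
            then obtain P where P: "P \<subseteq> edges (complete_bipartite A\<^sub>2 B\<^sub>2)" "path_between i y P"
              "alternating M\<^sub>2 P" "\<forall>e\<in>P. w e < ?t" "card (P - M\<^sub>2) < card (P \<inter> M\<^sub>2)"
              using exchange_walk_partner_path[OF bij2 assms(13) iA _ walk(3)] M2 walk(4) by blast
            moreover have "edges (complete_bipartite A\<^sub>2 B\<^sub>2) \<subseteq> edges ?G"
              by (auto simp: complete_bipartite_def)
            moreover have "\<exists>a'\<in>verts S\<^sub>\<mu> \<inter> A\<^sub>1. w {a', y} < ?t"
              using mu True wy by blast
            moreover have "\<exists>b'\<in>verts S\<^sub>\<nu> \<inter> B\<^sub>1. w {i, b'} < ?t"
              using walk(1) by (simp add: I_def)
            moreover have "y \<in> B\<^sub>2"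
              using walk m2B by blast
            ultimately show False
              using assms(28) iA by (meson order_trans)
          qed
          then have "n y \<in> verts S\<^sub>\<nu>"
            using True tree(3) by blast
          then show ?thesis
            using stay True by (simp add: m3_def)
        next
          case False
          then have n2: "n y \<in> A\<^sub>2"
            using nA yB by blast
          then have "(x, n y) \<in> ?R2"
            using walk wy by (simp add: exchange_def insert_commute)
          then have "(i, n y) \<in> ?R2\<^sup>*"
            using walk(3) by (rule rtrancl_into_rtrancl[rotated])
          then show ?thesis
            using n2 False m1a walk(1) by (auto simp: m3_def S_def)
        qed
      qed
    qed
    have "inj_on m3 (A\<^sub>1 \<union> A\<^sub>2)"
    proof (rule inj_onI)
      fix x y assume xy: "x \<in> A\<^sub>1 \<union> A\<^sub>2" "y \<in> A\<^sub>1 \<union> A\<^sub>2" "m3 x = m3 y"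
      have "x \<in> A\<^sub>1 \<longleftrightarrow> y \<in> A\<^sub>1"
        using xy m1B[of x] m1B[of y] m2B[of x] m2B[of y] dis(6)
        by (auto simp: m3_def split: if_splits)
      then show "x = y"
        using xy inj_onD[OF bij_betw_imp_inj_on[OF bij1], of x y]
          inj_onD[OF bij_betw_imp_inj_on[OF bij2], of x y]
        by (auto simp: m3_def split: if_splits)
    qed
    then have "inj_on (m3 \<circ> n) S"
      using injn nA SB by (meson comp_inj_on image_mono inj_on_subset order_trans)
    moreover have "(m3 \<circ> n) ` S \<subseteq> S - {m1 a}"
      using closed by auto
    moreover have finS: "finite S"
      using SB fin3(2) finite_subset by blast
    ultimately have "card S \<le> card (S - {m1 a})"
      by (intro card_inj_on_le[of "m3 \<circ> n"] finite_Diff)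
    moreover have "m1 a \<in> S"
      using tree(2) m1B[OF a(1)] by (simp add: S_def)
    ultimately show False
      using card_Diff1_less[OF finS] by (meson not_less)
  qed
  then show ?thesis
    using mcm max3 unfolding bot_solution_def is_arg_min_def by auto
qed

end
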